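(* Let $G$ and $H$ be finite abelian groups, let $K \leq H$ be a subgroup, and let $\phi \colon G \to H/K$ be a homomorphism. Let $s \geq 2$ be an integer. Then there exist a proper coset progression $C \subseteq G$ of rank at most $\log_2 |K|$ and size $|C| \geq s^{- \log_2 |K|}|G|$ and a Freiman $s$-homomorphism $\psi \colon C \to H$ such that $\phi(x) = \psi(x) + K$ for all $x \in C$.
   Context: A coset progression in an abelian group is a set $P_1+\dots+P_d+K'$ with $P_i$ arithmetic progressions and $K'$ a subgroup; $d$ is its rank; it is proper if $|P_1+\dots+P_d+K'| = |P_1|\cdots|P_d||K'|$. A map $\psi\colon C\to H$ is a Freiman $s$-homomorphism if whenever $x_1,\dots,x_s,y_1,\dots,y_s\in C$ satisfy $x_1+\dots+x_s=y_1+\dots+y_s$, then $\psi(x_1)+\dots+\psi(x_s)=\psi(y_1)+\dots+\psi(y_s)$. $\log_2$ is the base-2 logarithm. *)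

theory Defs
  imports Complex_Main "HOL-Algebra.Algebra"
begin

text \<open>
  Abelian groups are written multiplicatively: the sumset \<open>A + B\<close> is \<open>A <#>\<^bsub>G\<^esub> B\<close>,
  and the coset \<open>h + K\<close> is \<open>K #>\<^bsub>H\<^esub> h\<close>, an element of \<open>H Mod K\<close>.
\<close>

definition arith_prog :: "('a, 'm) monoid_scheme \<Rightarrow> 'a set \<Rightarrow> bool" where
  "arith_prog G P \<longleftrightarrow>
     (\<exists>a \<in> carrier G. \<exists>v \<in> carrier G. \<exists>L::nat. L \<ge> 1 \<and>
        P = {a \<otimes>\<^bsub>G\<^esub> (v [^]\<^bsub>G\<^esub> l) | l::nat. l < L})"

text \<open>
  Rank and properness depend on the presentation \<open>P\<^sub>1 + \<dots> + P\<^sub>d + K'\<close> and not only on the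
  underlying set, so the presentation is an argument. The rank is \<^term>\<open>length Ps\<close>; rank 0 is
  allowed and gives the subgroup \<open>K'\<close> itself.
\<close>

definition coset_progression ::
  "('a, 'm) monoid_scheme \<Rightarrow> 'a set list \<Rightarrow> 'a set \<Rightarrow> 'a set \<Rightarrow> bool" where
  "coset_progression G Ps K' C \<longleftrightarrow>
     (\<forall>P \<in> set Ps. arith_prog G P) \<and> subgroup K' G \<and>
     C = foldr (\<lambda>P Q. P <#>\<^bsub>G\<^esub> Q) Ps K'"

definition proper_coset_progression ::
  "('a, 'm) monoid_scheme \<Rightarrow> 'a set list \<Rightarrow> 'a set \<Rightarrow> 'a set \<Rightarrow> bool" where
  "proper_coset_progression G Ps K' C \<longleftrightarrow>
     coset_progression G Ps K' C \<and> card C = prod_list (map card Ps) * card K'"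

definition freiman_hom ::
  "nat \<Rightarrow> ('a, 'm) monoid_scheme \<Rightarrow> ('b, 'n) monoid_scheme \<Rightarrow> 'a set \<Rightarrow> ('a \<Rightarrow> 'b) \<Rightarrow> bool" where
  "freiman_hom s G H C \<psi> \<longleftrightarrow>
     \<psi> \<in> C \<rightarrow> carrier H \<and>
     (\<forall>x \<in> {1..s} \<rightarrow> C. \<forall>y \<in> {1..s} \<rightarrow> C.
        (\<Otimes>\<^bsub>G\<^esub>i\<in>{1..s}. x i) = (\<Otimes>\<^bsub>G\<^esub>i\<in>{1..s}. y i) \<longrightarrow>
        (\<Otimes>\<^bsub>H\<^esub>i\<in>{1..s}. \<psi> (x i)) = (\<Otimes>\<^bsub>H\<^esub>i\<in>{1..s}. \<psi> (y i)))"

end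

(*
  Let E be the subgroup of G x H of pairs (g, h) with phi g = h + K; its projection to G is onto, with
  kernel a copy of K, and a section of the projection on C is the same as a lift psi of phi. Sections
  are built by induction on the size of the kernel, for an arbitrary subgroup D of E. If the kernel
  contains some k other than the identity, let M be a maximal subgroup of D that avoids k. Every
  nontrivial subgroup of D/M contains the image of k, so D/M is cyclic, generated by the image of some
  v, and the kernel of the projection of M has at most half the size of that of D. Let w be the
  projection of v and N the least positive integer such that N w is in the projection of M. To the
  progression obtained for M add {0, w, ..., (L - 1) w} with L = ceil (N / s), and lift w to v: since
  s (L - 1) < N, the multiples of w cannot wrap around in a sum of s elements. Each step costs
  a factor at most s in density and one in rank, and there are at most log2 |K| steps.
*)

theory Submission
  imports Defs
begin

section \<open>Finite abelian groups with a unique minimal subgroup\<close>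

text \<open>Every prime dividing the order of an element equals \<open>p = ord k\<close>, and the
  elements of exponent \<open>p\<close> are powers of \<open>k\<close>. An element \<open>x\<close>
  of largest order then generates: an element of least order outside its powers would either differ
  from a power of \<open>x\<close> by a power of \<open>k\<close>, itself a power of
  \<open>x\<close>, or have larger order than \<open>x\<close>.\<close>

lemma (in comm_group) unique_minimal_subgroup_imp_cyclic:
  assumes fin: "finite (carrier G)"
    and k: "k \<in> carrier G" "k \<noteq> \<one>"
    and min: "\<And>x. x \<in> carrier G \<Longrightarrow> x \<noteq> \<one> \<Longrightarrow> \<exists>n::nat. x [^] n = k"
  shows "\<exists>x \<in> carrier G. carrier G = range (\<lambda>n::nat. x [^] n)"
proof -
  have ord_pos: "0 < ord x" if "x \<in> carrier G" for x
    using ord_ge_1[OF fin that] by simp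
  \<comment> \<open>\<open>k\<close> is a power of \<open>z\<close>, so its order divides the prime
    \<open>q\<close>; it is not 1 because \<open>k\<close> is not the identity.\<close>
  have ord_prime: "ord k = q" if "Factorial_Ring.prime q" "z \<in> carrier G" "ord z = q" for z q
  proof -
    have "z \<noteq> \<one>"
      using that ord_eq_1[of z] not_prime_1 by metis
    then obtain n :: nat where n: "z [^] n = k"
      using min \<open>z \<in> carrier G\<close> by blast
    have "k [^] q = \<one>"
      using n that by (metis mult.commute nat_pow_one nat_pow_pow pow_ord_eq_1)
    then have "ord k dvd q"
      using k pow_eq_id by simp
    moreover have "ord k \<noteq> 1"
      using k ord_eq_1 by simp
    ultimately show ?thesis
      using \<open>Factorial_Ring.prime q\<close> prime_nat_iff by auto
  qed
  \<comment> \<open>Reduces to prime order: if \<open>ord z = q * m\<close>, then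
    \<open>z [^] m\<close> has order \<open>q\<close>.\<close>
  have prime_divisor: "ord k = q" if "Factorial_Ring.prime q" "z \<in> carrier G" "q dvd ord z" for z q
  proof -
    obtain m where m: "ord z = q * m"
      using \<open>q dvd ord z\<close> by blast
    then have "m \<noteq> 0"
      using ord_pos[OF that(2)] by auto
    then have "ord (z [^] m) = q"
      using ord_pow[OF that(2), of m] m by simp
    then show ?thesis
      using ord_prime[OF \<open>Factorial_Ring.prime q\<close>, of "z [^] m"] that(2) by simp
  qed
  define p where "p = ord k"
  have p: "Factorial_Ring.prime p"
  proof -
    have "ord k \<noteq> 1"
      using k ord_eq_1 by simp
    then obtain q where "Factorial_Ring.prime q" "q dvd ord k"
      using prime_factor_nat by blast
    then show ?thesis
      using prime_divisor k(1) p_def by blast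
  qed
  \<comment> \<open>\<open>k\<close> is the \<open>n\<close>-th power of \<open>w\<close> with
    \<open>n\<close> prime to \<open>p\<close>; an inverse \<open>m\<close> of \<open>n\<close>
    modulo \<open>p\<close> recovers \<open>w\<close> as \<open>k [^] m\<close>.\<close>
  have torsion: "\<exists>m::nat. w = k [^] m" if w: "w \<in> carrier G" "w [^] p = \<one>" for w
  proof (cases "w = \<one>")
    case True
    then show ?thesis
      by (metis nat_pow_0)
  next
    case False
    then obtain n :: nat where n: "w [^] n = k"
      using min w by blast
    have "\<not> p dvd n"
    proof
      assume "p dvd n"
      then obtain j where "n = p * j"
        by blast
      then have "w [^] n = \<one>"
        using w by (simp flip: nat_pow_pow)
      then show False
        using n k by simp
    qed
    then have "gcd n p = 1"
      using p prime_imp_coprime coprime_commute coprime_imp_gcd_eq_1 by blast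
    moreover have "n \<noteq> 0"
      using n k by (metis nat_pow_0)
    ultimately obtain m j where eq: "n * m = p * j + 1"
      using bezout_nat[of n p] by metis
    have "k [^] m = w [^] (n * m)"
      using w n by (simp flip: nat_pow_pow)
    also have "\<dots> = w"
      unfolding eq using w by (simp add: nat_pow_mult[symmetric] flip: nat_pow_pow)
    finally show ?thesis
      by metis
  qed
  have "finite (ord ` carrier G)" "ord ` carrier G \<noteq> {}"
    using fin by auto
  then have "Max (ord ` carrier G) \<in> ord ` carrier G"
    by (rule Max_in)
  then obtain x where x: "x \<in> carrier G" "ord x = Max (ord ` carrier G)"
    by auto
  have x_max: "ord y \<le> ord x" if "y \<in> carrier G" for y
    using that x fin by simp
  \<comment> \<open>\<open>ord x\<close> is at least \<open>ord k = p > 1\<close>, so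
    \<open>x\<close> is not the identity and \<open>min\<close> applies to it.\<close>
  have "k \<in> range (\<lambda>n::nat. x [^] n)"
  proof -
    have "x \<noteq> \<one>"
      using x_max[OF k(1)] prime_gt_1_nat[OF p] ord_id p_def by auto
    then show ?thesis
      using min x(1) by (metis rangeI)
  qed
  then obtain n where n: "k = x [^] (n::nat)"
    by blast
  have "carrier G \<subseteq> range (\<lambda>n::nat. x [^] n)"
  proof (rule ccontr)
    assume "\<not> ?thesis"
    then obtain y0 where "y0 \<in> carrier G \<and> y0 \<notin> range (\<lambda>n::nat. x [^] n)"
      by blast
    \<comment> \<open>\<open>y\<close> has least order outside the powers of \<open>x\<close>; since
      \<open>y [^] p\<close> has smaller order, it must be one of these powers.\<close>
    then obtain y where y: "y \<in> carrier G" "y \<notin> range (\<lambda>n::nat. x [^] n)"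
      and y_min: "\<And>z. z \<in> carrier G \<Longrightarrow> z \<notin> range (\<lambda>n::nat. x [^] n) \<Longrightarrow> ord y \<le> ord z"
      using ex_has_least_nat[of "\<lambda>y. y \<in> carrier G \<and> y \<notin> range (\<lambda>n::nat. x [^] n)" y0 ord]
      by blast
    have "y \<noteq> \<one>"
      using y by (metis nat_pow_0 rangeI)
    then have "ord y \<noteq> 1"
      using y ord_eq_1 by simp
    then obtain q where "Factorial_Ring.prime q" "q dvd ord y"
      using prime_factor_nat by blast
    then have pdvd: "p dvd ord y"
      using prime_divisor y(1) p_def by blast
    have ord_yp: "ord (y [^] p) = ord y div p"
      using ord_pow[OF y(1) pdvd] prime_gt_0_nat[OF p] by simp
    also have "\<dots> < ord y"
      using ord_pos[OF y(1)] prime_gt_1_nat[OF p] by simp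
    finally have "y [^] p \<in> range (\<lambda>n::nat. x [^] n)"
      using y_min[of "y [^] p"] y(1) by auto
    then obtain a :: nat where a: "y [^] p = x [^] a"
      by blast
    show False
    proof (cases "p dvd a")
      case True
      then obtain c where c: "a = c * p"
        by (metis dvdE mult.commute)
      \<comment> \<open>Dividing \<open>y\<close> by \<open>x [^] c\<close>, a \<open>p\<close>-th
        root of \<open>y [^] p\<close>, leaves an element of exponent \<open>p\<close>, hence a
        power of \<open>k\<close> and so of \<open>x\<close>.\<close>
      define w where "w = y \<otimes> inv (x [^] c)"
      have w: "w \<in> carrier G"
        using w_def x y by simp
      have "w [^] p = y [^] p \<otimes> inv (x [^] a)"
        unfolding w_def c using x y by (simp add: nat_pow_distrib nat_pow_inv nat_pow_pow)
      also have "\<dots> = \<one>"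
        using a x by simp
      finally obtain m :: nat where m: "w = k [^] m"
        using torsion[OF w] by blast
      have "y = w \<otimes> x [^] c"
        unfolding w_def using x y by (simp add: m_assoc)
      also have "\<dots> = x [^] (n * m + c)"
        unfolding m n using x by (simp add: nat_pow_mult nat_pow_pow)
      finally show False
        using y by blast
    next
      case False
      \<comment> \<open>Only the prime \<open>p\<close> can divide \<open>ord x\<close>, so
        \<open>y [^] p = x [^] a\<close> has the full order of \<open>x\<close>, which forces
        \<open>ord y = p * ord x\<close>.\<close>
      have "coprime (ord x) a"
      proof (rule ccontr)
        assume "\<not> coprime (ord x) a"
        then have "gcd (ord x) a \<noteq> 1"
          by (simp add: coprime_iff_gcd_eq_1)
        then obtain r where "Factorial_Ring.prime r" "r dvd gcd (ord x) a"
          using prime_factor_nat by blast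
        then have "r = p" "r dvd a"
          using prime_divisor[of r x] x p_def by auto
        then show False
          using False by simp
      qed
      moreover have "a \<noteq> 0"
        using False by (metis dvd_0_right)
      ultimately have "ord (x [^] a) = ord x"
        using ord_pow_gen[OF x(1), of a] by simp
      then have "ord y = p * ord x"
        using a ord_yp pdvd by simp
      then have "ord y > ord x"
        using ord_pos[OF x(1)] prime_gt_1_nat[OF p] by simp
      then show False
        using x_max[OF y(1)] by simp
    qed
  qed
  then have "carrier G = range (\<lambda>n::nat. x [^] n)"
    using x(1) by auto
  then show ?thesis
    using x(1) by blast
qed

text \<open>\<open>M\<close> is a maximal subgroup avoiding \<open>k\<close>. Any subgroup properly
  containing \<open>M\<close> contains \<open>k\<close>, so every nontrivial element of
  \<open>G Mod M\<close> has the coset of \<open>k\<close> among its powers, and the quotient is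
  cyclic; \<open>v\<close> represents a generator.\<close>

lemma (in comm_group) subgroup_avoiding_with_cyclic_quotient:
  assumes fin: "finite (carrier G)"
    and k: "k \<in> carrier G" "k \<noteq> \<one>"
  shows "\<exists>M. subgroup M G \<and> k \<notin> M \<and>
           (\<exists>v \<in> carrier G. \<forall>g \<in> carrier G. \<exists>(n::nat). \<exists>m \<in> M. g = m \<otimes> v [^] n)"
proof -
  define S where "S = {M. subgroup M G \<and> k \<notin> M}"
  have "S \<subseteq> Pow (carrier G)"
    unfolding S_def using subgroup.subset by blast
  then have "finite S"
    using fin finite_subset by blast
  moreover have "{\<one>} \<in> S"
    unfolding S_def using k triv_subgroup by simp
  ultimately obtain M where "M \<in> S" and max: "\<And>N. N \<in> S \<Longrightarrow> M \<subseteq> N \<Longrightarrow> M = N"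
    by (metis empty_iff finite_has_maximal)
  then have M: "subgroup M G" "k \<notin> M"
    by (auto simp: S_def)
  interpret N: normal M G
    using M normal_iff_subgroup by simp
  interpret Q: comm_group "G Mod M"
    using M abelian_FactGroup by simp
  have "\<exists>Y \<in> carrier (G Mod M). carrier (G Mod M) = range (\<lambda>n::nat. Y [^]\<^bsub>G Mod M\<^esub> n)"
  proof (rule Q.unique_minimal_subgroup_imp_cyclic)
    show "finite (carrier (G Mod M))"
      using fin by (simp add: carrier_FactGroup)
    show "M #> k \<in> carrier (G Mod M)"
      using k by (simp add: carrier_FactGroup)
    show "M #> k \<noteq> \<one>\<^bsub>G Mod M\<^esub>"
      using M k coset_join1 N.subset by auto
  next
    fix Y assume Y: "Y \<in> carrier (G Mod M)" "Y \<noteq> \<one>\<^bsub>G Mod M\<^esub>"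
    then obtain y where y: "y \<in> carrier G" "Y = M #> y"
      by (auto simp: carrier_FactGroup)
    have "y \<notin> M"
      using Y y M coset_join2 by auto
    have gen: "subgroup (generate G {y}) G"
      using y generate_is_subgroup by simp
    \<comment> \<open>This subgroup contains \<open>M\<close> and also \<open>y\<close>, which is
      not in \<open>M\<close>; by maximality it contains \<open>k\<close>.\<close>
    let ?N = "M <#> generate G {y}"
    have sub: "subgroup ?N G"
      using mult_subgroups M gen by blast
    have "M \<subseteq> ?N"
      using subgroup.one_closed[OF gen] N.subset unfolding set_mult_def
      by (force intro: r_one[symmetric])
    moreover have "y \<in> ?N"
      using subgroup.one_closed[OF M(1)] generate.incl[of y "{y}" G] y unfolding set_mult_def
      by (force intro: l_one[symmetric])
    ultimately have "k \<in> ?N"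
      using max[of ?N] sub \<open>y \<notin> M\<close> unfolding S_def by auto
    \<comment> \<open>Finiteness makes the subgroup generated by \<open>y\<close> consist of
      natural-number powers, the form in which the cyclicity criterion is stated.\<close>
    then obtain m n where mn: "m \<in> M" "k = m \<otimes> y [^] (n::nat)"
      unfolding set_mult_def generate_pow_on_finite_carrier[OF fin y(1)] by auto
    then have "k \<in> M #> y [^] n"
      unfolding r_coset_def by blast
    then have "M #> k = M #> y [^] n"
      using repr_independence M y by (metis nat_pow_closed)
    then show "\<exists>n::nat. Y [^]\<^bsub>G Mod M\<^esub> n = M #> k"
      using N.FactGroup_pow[OF y(1)] y(2) by metis
  qed
  then obtain Y where Y: "Y \<in> carrier (G Mod M)"
      "carrier (G Mod M) = range (\<lambda>n::nat. Y [^]\<^bsub>G Mod M\<^esub> n)"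
    by blast
  then obtain v where v: "v \<in> carrier G" "Y = M #> v"
    unfolding carrier_FactGroup by blast
  have "\<exists>(n::nat). \<exists>m \<in> M. g = m \<otimes> v [^] n" if g: "g \<in> carrier G" for g
  proof -
    have "M #> g \<in> carrier (G Mod M)"
      using g by (simp add: carrier_FactGroup)
    then obtain n :: nat where "M #> g = M #> v [^] n"
      using Y N.FactGroup_pow[OF v(1)] v(2) by auto
    then have "g \<in> M #> v [^] n"
      using rcos_self g M by blast
    then show ?thesis
      unfolding r_coset_def by blast
  qed
  then show ?thesis
    using M v(1) by blast
qed

section \<open>Finite products, and powers of an element modulo a subgroup\<close>

lemma hom_finprod:
  assumes "comm_group G" "comm_group H" "h \<in> hom G H" "finite A" "f \<in> A \<rightarrow> carrier G"
  shows "h (\<Otimes>\<^bsub>G\<^esub>i\<in>A. f i) = (\<Otimes>\<^bsub>H\<^esub>i\<in>A. h (f i))"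
proof -
  interpret G: comm_group G by fact
  interpret H: comm_group H by fact
  interpret group_hom G H h
    using assms by unfold_locales
  show ?thesis
    using assms(4,5) by (induction A) (auto simp: Pi_iff)
qed

context comm_group
begin

lemma finprod_nat_pow:
  assumes "finite A" "w \<in> carrier G"
  shows "(\<Otimes>i\<in>A. w [^] (l i :: nat)) = w [^] (\<Sum>i\<in>A. l i)"
  using assms by (induction A) (auto simp: nat_pow_mult)

lemma finprod_mem_subgroup:
  assumes "subgroup A G" "finite I" "f \<in> I \<rightarrow> A"
  shows "(\<Otimes>i\<in>I. f i) \<in> A"
proof -
  have AG: "A \<subseteq> carrier G"
    using assms(1) by (rule subgroup.subset)
  show ?thesis
    using assms(2,3)
  proof (induction I)
    case empty
    then show ?case
      using subgroup.one_closed[OF assms(1)] by simp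
  next
    case (insert i I)
    then have "f i \<in> A" "(\<Otimes>i\<in>I. f i) \<in> A"
      by auto
    moreover have "f \<in> I \<rightarrow> carrier G" "f i \<in> carrier G"
      using insert AG by auto
    ultimately show ?case
      using insert subgroup.m_closed[OF assms(1)] by simp
  qed
qed

text \<open>Cancelling the smaller power would put a power of \<open>w\<close> with positive
  exponent below \<open>N\<close> into \<open>A\<close>. This serves twice: for properness, with
  single elements, and for the Freiman property, with products of \<open>s\<close> elements.\<close>

lemma pow_coset_unique:
  fixes a b :: nat
  assumes A: "subgroup A G" and w: "w \<in> carrier G"
    and N: "\<And>n::nat. 0 < n \<Longrightarrow> n < N \<Longrightarrow> w [^] n \<notin> A"
    and ab: "a < N" "b < N" and cd: "c \<in> A" "d \<in> A"
    and eq: "w [^] a \<otimes> c = w [^] b \<otimes> d"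
  shows "a = b \<and> c = d"
proof -
  have AG: "\<And>x. x \<in> A \<Longrightarrow> x \<in> carrier G"
    using subgroup.subset[OF A] by blast
  have *: "i = j" if "i \<le> j" "j < N" "x \<in> A" "y \<in> A" "w [^] i \<otimes> x = w [^] j \<otimes> y"
    for i j :: nat and x y
  proof (rule ccontr)
    assume "i \<noteq> j"
    have "w [^] j = w [^] i \<otimes> w [^] (j - i)"
      using \<open>i \<le> j\<close> w by (simp add: nat_pow_mult)
    then have "w [^] i \<otimes> x = w [^] i \<otimes> (w [^] (j - i) \<otimes> y)"
      using that AG w by (simp add: m_assoc)
    then have "x = w [^] (j - i) \<otimes> y"
      using that AG w by simp
    then have "w [^] (j - i) = x \<otimes> inv y"
      using that AG w by (simp add: m_assoc)
    then have "w [^] (j - i) \<in> A"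
      using A that by (simp add: subgroup.m_closed subgroup.m_inv_closed)
    then show False
      using N[of "j - i"] \<open>i \<noteq> j\<close> that by simp
  qed
  have "a = b"
    using *[of a b c d] *[of b a d c] ab cd eq by (metis nat_le_linear)
  then show ?thesis
    using eq cd AG w by simp
qed

lemma least_pow_mem_subgroup:
  assumes fin: "finite (carrier G)" and A: "subgroup A G" and w: "w \<in> carrier G"
  obtains N :: nat where "0 < N" "w [^] N \<in> A" "\<And>n::nat. 0 < n \<Longrightarrow> n < N \<Longrightarrow> w [^] n \<notin> A"
proof -
  have "0 < ord w \<and> w [^] ord w \<in> A"
    using ord_ge_1[OF fin w] w subgroup.one_closed[OF A] by simp
  then show thesis
    using that exists_least_iff[of "\<lambda>n. 0 < n \<and> w [^] n \<in> A"] by blast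
qed

end

section \<open>Adjoining a progression and extending the lift\<close>

text \<open>Injectivity on pairs gives the sumset exactly \<open>L * card C\<close> elements, so
  properness passes from \<open>C\<close> to the longer presentation. The factor
  \<open>\<one>\<close> in \<open>P\<close> is the base point in the form of
  \<open>arith_prog\<close>.\<close>

lemma proper_coset_progression_Cons:
  fixes G (structure)
  assumes "comm_group G" "proper_coset_progression G Ps K' C" "w \<in> carrier G" "1 \<le> L"
    and inj: "inj_on (\<lambda>(l::nat, c). w [^] l \<otimes> c) ({..<L} \<times> C)" and "C \<subseteq> carrier G" "C \<noteq> {}"
  defines "P \<equiv> {\<one> \<otimes> w [^] l | l::nat. l < L}"
  shows "P <#> C = (\<lambda>(l, c). w [^] l \<otimes> c) ` ({..<L} \<times> C)"
    and "card (P <#> C) = L * card C"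
    and "proper_coset_progression G (P # Ps) K' (P <#> C)"
proof -
  interpret comm_group G by fact
  have P: "P = (\<lambda>l. w [^] l) ` {..<L}"
    unfolding P_def using assms(3) by auto
  show eq: "P <#> C = (\<lambda>(l, c). w [^] l \<otimes> c) ` ({..<L} \<times> C)"
    unfolding P set_mult_def by auto
  show card: "card (P <#> C) = L * card C"
    unfolding eq using inj by (simp add: card_image card_cartesian_product)
  \<comment> \<open>A fixed element of \<open>C\<close> turns injectivity on pairs into injectivity
    of the powers, so that \<open>P\<close> has exactly \<open>L\<close> elements.\<close>
  obtain c where c: "c \<in> C"
    using assms by blast
  have "inj_on (\<lambda>l::nat. w [^] l) {..<L}"
  proof (rule inj_onI)
    fix i j :: nat assume "i \<in> {..<L}" "j \<in> {..<L}" "w [^] i = w [^] j"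
    then show "i = j"
      using inj_onD[OF inj, of "(i, c)" "(j, c)"] c by simp
  qed
  then have "card P = L"
    unfolding P by (simp add: card_image)
  moreover have "arith_prog G P"
    unfolding arith_prog_def P_def using assms(3,4) by blast
  ultimately show "proper_coset_progression G (P # Ps) K' (P <#> C)"
    using assms(2) card unfolding proper_coset_progression_def coset_progression_def by auto
qed

text \<open>In a product of \<open>s\<close> elements the exponents of \<open>w\<close> add up to at
  most \<open>s * (L - 1) < N\<close>, so the product determines both this total and the product of
  the \<open>C\<close>-parts. By the Freiman property of \<open>\<psi>\<close>, these two data
  determine the product of the values of \<open>\<psi>'\<close>.\<close>

lemma freiman_hom_extend:
  fixes G :: "('a, 'm) monoid_scheme" and E :: "('b, 'n) monoid_scheme" and L N s :: nat
  assumes G: "comm_group G" and E: "comm_group E"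
    and \<psi>: "freiman_hom s G E C \<psi>"
    and A: "subgroup A G" "C \<subseteq> A" and w: "w \<in> carrier G" and v: "v \<in> carrier E"
    and N: "\<And>n::nat. 0 < n \<Longrightarrow> n < N \<Longrightarrow> w [^]\<^bsub>G\<^esub> n \<notin> A"
    and L: "s * (L - 1) < N"
    and \<psi>': "\<And>l c. l < L \<Longrightarrow> c \<in> C \<Longrightarrow> \<psi>' (w [^]\<^bsub>G\<^esub> l \<otimes>\<^bsub>G\<^esub> c) = v [^]\<^bsub>E\<^esub> l \<otimes>\<^bsub>E\<^esub> \<psi> c"
  shows "freiman_hom s G E ((\<lambda>(l, c). w [^]\<^bsub>G\<^esub> l \<otimes>\<^bsub>G\<^esub> c) ` ({..<L} \<times> C)) \<psi>'"
    (is "freiman_hom s G E (?F ` ?D) \<psi>'")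
proof -
  interpret G: comm_group G by fact
  interpret E: comm_group E by fact
  have CG: "C \<subseteq> carrier G"
    using A subgroup.subset by blast
  have \<psi>C: "\<And>c. c \<in> C \<Longrightarrow> \<psi> c \<in> carrier E"
    using \<psi> unfolding freiman_hom_def by auto
  \<comment> \<open>Each factor is split into a power and a \<open>C\<close>-part; commutativity
    then collects the two kinds, in \<open>G\<close> and in \<open>E\<close> with the same
    exponents.\<close>
  have decompose: "\<exists>l c. (\<forall>i\<in>{1..s}. x i = w [^]\<^bsub>G\<^esub> l i \<otimes>\<^bsub>G\<^esub> c i) \<and> c \<in> {1..s} \<rightarrow> C
      \<and> (\<Sum>i\<in>{1..s}. l i) < N
      \<and> (\<Otimes>\<^bsub>G\<^esub>i\<in>{1..s}. x i) = w [^]\<^bsub>G\<^esub> (\<Sum>i\<in>{1..s}. l i) \<otimes>\<^bsub>G\<^esub> (\<Otimes>\<^bsub>G\<^esub>i\<in>{1..s}. c i)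
      \<and> (\<Otimes>\<^bsub>E\<^esub>i\<in>{1..s}. \<psi>' (x i)) = v [^]\<^bsub>E\<^esub> (\<Sum>i\<in>{1..s}. l i) \<otimes>\<^bsub>E\<^esub> (\<Otimes>\<^bsub>E\<^esub>i\<in>{1..s}. \<psi> (c i))"
    if x: "x \<in> {1..s} \<rightarrow> ?F ` ?D" for x
  proof -
    have "\<forall>i\<in>{1..s}. \<exists>lc. fst lc < L \<and> snd lc \<in> C \<and> x i = w [^]\<^bsub>G\<^esub> fst lc \<otimes>\<^bsub>G\<^esub> snd lc"
      using x by (fastforce simp: Pi_iff)
    then obtain lc where lc: "\<And>i. i \<in> {1..s} \<Longrightarrow>
        fst (lc i) < L \<and> snd (lc i) \<in> C \<and> x i = w [^]\<^bsub>G\<^esub> fst (lc i) \<otimes>\<^bsub>G\<^esub> snd (lc i)"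
      by metis
    define l where "l = fst \<circ> lc"
    define c where "c = snd \<circ> lc"
    have l: "\<And>i. i \<in> {1..s} \<Longrightarrow> l i < L" and c: "c \<in> {1..s} \<rightarrow> C"
      and xlc: "\<And>i. i \<in> {1..s} \<Longrightarrow> x i = w [^]\<^bsub>G\<^esub> l i \<otimes>\<^bsub>G\<^esub> c i"
      using lc by (auto simp: l_def c_def)
    have cG: "c \<in> {1..s} \<rightarrow> carrier G" and cE: "(\<lambda>i. \<psi> (c i)) \<in> {1..s} \<rightarrow> carrier E"
      using c CG \<psi>C by (auto simp: Pi_iff)
    have "(\<Sum>i\<in>{1..s}. l i) \<le> (\<Sum>i\<in>{1..s}. L - 1)"
      by (rule sum_mono) (use l in fastforce)
    also have "\<dots> < N"
      using L by simp
    finally have "(\<Sum>i\<in>{1..s}. l i) < N" .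
    moreover have "(\<Otimes>\<^bsub>G\<^esub>i\<in>{1..s}. x i) = (\<Otimes>\<^bsub>G\<^esub>i\<in>{1..s}. w [^]\<^bsub>G\<^esub> l i \<otimes>\<^bsub>G\<^esub> c i)"
      by (rule G.finprod_cong') (use xlc w cG in \<open>auto simp: Pi_iff\<close>)
    then have "(\<Otimes>\<^bsub>G\<^esub>i\<in>{1..s}. x i) =
        w [^]\<^bsub>G\<^esub> (\<Sum>i\<in>{1..s}. l i) \<otimes>\<^bsub>G\<^esub> (\<Otimes>\<^bsub>G\<^esub>i\<in>{1..s}. c i)"
      using cG w by (simp add: G.finprod_multf G.finprod_nat_pow)
    moreover have "(\<Otimes>\<^bsub>E\<^esub>i\<in>{1..s}. \<psi>' (x i)) = (\<Otimes>\<^bsub>E\<^esub>i\<in>{1..s}. v [^]\<^bsub>E\<^esub> l i \<otimes>\<^bsub>E\<^esub> \<psi> (c i))"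
      by (rule E.finprod_cong') (use xlc \<psi>' l c v cE in \<open>auto simp: Pi_iff\<close>)
    then have "(\<Otimes>\<^bsub>E\<^esub>i\<in>{1..s}. \<psi>' (x i)) =
        v [^]\<^bsub>E\<^esub> (\<Sum>i\<in>{1..s}. l i) \<otimes>\<^bsub>E\<^esub> (\<Otimes>\<^bsub>E\<^esub>i\<in>{1..s}. \<psi> (c i))"
      using cE v by (simp add: E.finprod_multf E.finprod_nat_pow)
    ultimately show ?thesis
      using xlc c by blast
  qed
  show ?thesis
    unfolding freiman_hom_def
  proof (intro conjI ballI impI)
    show "\<psi>' \<in> ?F ` ?D \<rightarrow> carrier E"
      using \<psi>' \<psi>C v by auto
  next
    fix x y assume x: "x \<in> {1..s} \<rightarrow> ?F ` ?D" and y: "y \<in> {1..s} \<rightarrow> ?F ` ?D"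
      and eq: "(\<Otimes>\<^bsub>G\<^esub>i\<in>{1..s}. x i) = (\<Otimes>\<^bsub>G\<^esub>i\<in>{1..s}. y i)"
    obtain l c where lc: "c \<in> {1..s} \<rightarrow> C" "(\<Sum>i\<in>{1..s}. l i) < N"
        "(\<Otimes>\<^bsub>G\<^esub>i\<in>{1..s}. x i) = w [^]\<^bsub>G\<^esub> (\<Sum>i\<in>{1..s}. l i) \<otimes>\<^bsub>G\<^esub> (\<Otimes>\<^bsub>G\<^esub>i\<in>{1..s}. c i)"
        "(\<Otimes>\<^bsub>E\<^esub>i\<in>{1..s}. \<psi>' (x i)) = v [^]\<^bsub>E\<^esub> (\<Sum>i\<in>{1..s}. l i) \<otimes>\<^bsub>E\<^esub> (\<Otimes>\<^bsub>E\<^esub>i\<in>{1..s}. \<psi> (c i))"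
      using decompose[OF x] by blast
    obtain m d where md: "d \<in> {1..s} \<rightarrow> C" "(\<Sum>i\<in>{1..s}. m i) < N"
        "(\<Otimes>\<^bsub>G\<^esub>i\<in>{1..s}. y i) = w [^]\<^bsub>G\<^esub> (\<Sum>i\<in>{1..s}. m i) \<otimes>\<^bsub>G\<^esub> (\<Otimes>\<^bsub>G\<^esub>i\<in>{1..s}. d i)"
        "(\<Otimes>\<^bsub>E\<^esub>i\<in>{1..s}. \<psi>' (y i)) = v [^]\<^bsub>E\<^esub> (\<Sum>i\<in>{1..s}. m i) \<otimes>\<^bsub>E\<^esub> (\<Otimes>\<^bsub>E\<^esub>i\<in>{1..s}. \<psi> (d i))"
      using decompose[OF y] by blast
    \<comment> \<open>\<open>C\<close> need not be closed under products, but products of its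
      elements stay in the subgroup \<open>A\<close>, modulo which exponents below \<open>N\<close>
      can be compared.\<close>
    have "(\<Otimes>\<^bsub>G\<^esub>i\<in>{1..s}. c i) \<in> A" "(\<Otimes>\<^bsub>G\<^esub>i\<in>{1..s}. d i) \<in> A"
      using lc(1) md(1) A(2) by (auto intro!: G.finprod_mem_subgroup[OF A(1)])
    then have sums: "(\<Sum>i\<in>{1..s}. l i) = (\<Sum>i\<in>{1..s}. m i)"
        and prods: "(\<Otimes>\<^bsub>G\<^esub>i\<in>{1..s}. c i) = (\<Otimes>\<^bsub>G\<^esub>i\<in>{1..s}. d i)"
      using G.pow_coset_unique[OF A(1) w N lc(2) md(2)] eq lc(3) md(3) by auto
    have "(\<Otimes>\<^bsub>E\<^esub>i\<in>{1..s}. \<psi> (c i)) = (\<Otimes>\<^bsub>E\<^esub>i\<in>{1..s}. \<psi> (d i))"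
      using \<psi> prods lc(1) md(1) unfolding freiman_hom_def by blast
    then show "(\<Otimes>\<^bsub>E\<^esub>i\<in>{1..s}. \<psi>' (x i)) = (\<Otimes>\<^bsub>E\<^esub>i\<in>{1..s}. \<psi>' (y i))"
      using sums lc(4) md(4) by simp
  qed
qed

text \<open>A product of values of \<open>\<psi>\<close> lies in \<open>D\<close> and projects to
  the product of the arguments, so injectivity on \<open>D\<close> makes it a function of the
  latter. This settles the base case of the induction.\<close>

lemma freiman_hom_section:
  assumes "comm_group G" "comm_group E" "\<pi> \<in> hom E G" "subgroup D E" "inj_on \<pi> D"
    and "\<psi> \<in> C \<rightarrow> D" "\<And>x. x \<in> C \<Longrightarrow> \<pi> (\<psi> x) = x"
  shows "freiman_hom s G E C \<psi>"
  unfolding freiman_hom_def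
proof (intro conjI ballI impI)
  interpret G: comm_group G by fact
  interpret E: comm_group E by fact
  have DE: "D \<subseteq> carrier E"
    using assms(4) by (rule subgroup.subset)
  then show "\<psi> \<in> C \<rightarrow> carrier E"
    using assms(6) by blast
  have *: "(\<Otimes>\<^bsub>E\<^esub>i\<in>{1..s}. \<psi> (x i)) \<in> D \<and>
      \<pi> (\<Otimes>\<^bsub>E\<^esub>i\<in>{1..s}. \<psi> (x i)) = (\<Otimes>\<^bsub>G\<^esub>i\<in>{1..s}. x i)" if x: "x \<in> {1..s} \<rightarrow> C" for x
  proof
    have xD: "(\<lambda>i. \<psi> (x i)) \<in> {1..s} \<rightarrow> D"
      using x assms(6) by (auto simp: Pi_iff)
    then show "(\<Otimes>\<^bsub>E\<^esub>i\<in>{1..s}. \<psi> (x i)) \<in> D"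
      using E.finprod_mem_subgroup[OF assms(4)] by blast
    have xE: "(\<lambda>i. \<psi> (x i)) \<in> {1..s} \<rightarrow> carrier E"
      using xD DE by blast
    then have "\<pi> (\<Otimes>\<^bsub>E\<^esub>i\<in>{1..s}. \<psi> (x i)) = (\<Otimes>\<^bsub>G\<^esub>i\<in>{1..s}. \<pi> (\<psi> (x i)))"
      using hom_finprod[OF assms(2,1,3), of "{1..s}"] by blast
    also have "\<dots> = (\<Otimes>\<^bsub>G\<^esub>i\<in>{1..s}. x i)"
    proof (rule G.finprod_cong')
      \<comment> \<open>That the arguments lie in \<open>carrier G\<close> is read off from this
        same equation.\<close>
      have "\<pi> (\<psi> (x i)) = x i \<and> \<pi> (\<psi> (x i)) \<in> carrier G" if "i \<in> {1..s}" for i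
      proof -
        have "x i \<in> C" "\<psi> (x i) \<in> carrier E"
          using x xE that by (auto simp: Pi_iff)
        moreover from this have "\<pi> (\<psi> (x i)) \<in> carrier G"
          using assms(3) unfolding hom_def by blast
        ultimately show ?thesis
          using assms(7) by blast
      qed
      note * = this
      show "\<pi> (\<psi> (x i)) = x i" if "i \<in> {1..s}" for i
        using *[OF that] by simp
      show "x \<in> {1..s} \<rightarrow> carrier G"
      proof
        show "x i \<in> carrier G" if "i \<in> {1..s}" for i
          using *[OF that] by metis
      qed
    qed simp
    finally show "\<pi> (\<Otimes>\<^bsub>E\<^esub>i\<in>{1..s}. \<psi> (x i)) = (\<Otimes>\<^bsub>G\<^esub>i\<in>{1..s}. x i)" .
  qed
  fix x y assume "x \<in> {1..s} \<rightarrow> C" "y \<in> {1..s} \<rightarrow> C"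
    and "(\<Otimes>\<^bsub>G\<^esub>i\<in>{1..s}. x i) = (\<Otimes>\<^bsub>G\<^esub>i\<in>{1..s}. y i)"
  then show "(\<Otimes>\<^bsub>E\<^esub>i\<in>{1..s}. \<psi> (x i)) = (\<Otimes>\<^bsub>E\<^esub>i\<in>{1..s}. \<psi> (y i))"
    using *[of x] *[of y] by (auto intro: inj_onD[OF assms(5)])
qed

section \<open>Counting: images, kernels and density\<close>

text \<open>Dividing the exponent \<open>n\<close> by \<open>N\<close> with remainder and absorbing
  the multiple of \<open>N\<close> into the image of \<open>M\<close> covers the image of
  \<open>D\<close> by \<open>N\<close> translates of the image of \<open>M\<close>, one for each
  remainder.\<close>

lemma card_hom_image_le:
  assumes "comm_group G" "finite (carrier G)" "\<pi> \<in> hom E G" "comm_group E"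
    and M: "subgroup M E" and v: "v \<in> carrier E"
    and gen: "\<And>d. d \<in> D \<Longrightarrow> \<exists>(n::nat). \<exists>m \<in> M. d = m \<otimes>\<^bsub>E\<^esub> v [^]\<^bsub>E\<^esub> n"
    and N: "0 < N" "\<pi> v [^]\<^bsub>G\<^esub> (N::nat) \<in> \<pi> ` M"
  shows "card (\<pi> ` D) \<le> N * card (\<pi> ` M)"
proof -
  interpret G: comm_group G by fact
  interpret E: comm_group E by fact
  interpret group_hom E G \<pi>
    using assms by unfold_locales
  have \<pi>M: "subgroup (\<pi> ` M) G"
    using M by (rule subgroup_img_is_subgroup)
  have "\<pi> ` D \<subseteq> (\<lambda>(r, a). \<pi> v [^]\<^bsub>G\<^esub> r \<otimes>\<^bsub>G\<^esub> a) ` ({..<N} \<times> \<pi> ` M)"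
  proof (rule image_subsetI)
    fix d assume "d \<in> D"
    then obtain n :: nat and m where nm: "m \<in> M" "d = m \<otimes>\<^bsub>E\<^esub> v [^]\<^bsub>E\<^esub> n"
      using gen by blast
    have mE: "m \<in> carrier E"
      using nm M subgroup.subset by blast
    have pow_in: "(\<pi> v [^]\<^bsub>G\<^esub> N) [^]\<^bsub>G\<^esub> j \<in> \<pi> ` M" for j :: nat
    proof (induction j)
      case 0
      then show ?case
        using subgroup.one_closed[OF \<pi>M] by simp
    next
      case (Suc j)
      then show ?case
        using subgroup.m_closed[OF \<pi>M _ N(2)] by simp
    qed
    have \<pi>v: "\<pi> v \<in> carrier G"
      using v by simp
    let ?a = "\<pi> m \<otimes>\<^bsub>G\<^esub> (\<pi> v [^]\<^bsub>G\<^esub> N) [^]\<^bsub>G\<^esub> (n div N)"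
    have "?a \<in> \<pi> ` M"
      using subgroup.m_closed[OF \<pi>M] pow_in nm by blast
    moreover have "\<pi> d = \<pi> v [^]\<^bsub>G\<^esub> (n mod N) \<otimes>\<^bsub>G\<^esub> ?a"
    proof -
      have "\<pi> d = \<pi> m \<otimes>\<^bsub>G\<^esub> \<pi> v [^]\<^bsub>G\<^esub> (N * (n div N) + n mod N)"
        using nm(2) mE v by (simp add: hom_nat_pow)
      also have "\<dots> = \<pi> m \<otimes>\<^bsub>G\<^esub> ((\<pi> v [^]\<^bsub>G\<^esub> N) [^]\<^bsub>G\<^esub> (n div N) \<otimes>\<^bsub>G\<^esub> \<pi> v [^]\<^bsub>G\<^esub> (n mod N))"
        unfolding G.nat_pow_mult[OF \<pi>v, symmetric] G.nat_pow_pow[OF \<pi>v] ..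
      also have "\<dots> = \<pi> v [^]\<^bsub>G\<^esub> (n mod N) \<otimes>\<^bsub>G\<^esub> ?a"
        using mE \<pi>v by (simp add: G.m_ac)
      finally show ?thesis .
    qed
    moreover have "n mod N \<in> {..<N}"
      using \<open>0 < N\<close> by simp
    ultimately show "\<pi> d \<in> (\<lambda>(r, a). \<pi> v [^]\<^bsub>G\<^esub> r \<otimes>\<^bsub>G\<^esub> a) ` ({..<N} \<times> \<pi> ` M)"
      by (intro image_eqI[where x = "(n mod N, ?a)"]) simp_all
  qed
  moreover have "finite (\<pi> ` M)"
    by (rule finite_subset[OF subgroup.subset[OF \<pi>M] assms(2)])
  ultimately have "card (\<pi> ` D) \<le> card ({..<N} \<times> \<pi> ` M)"
    by (meson finite_SigmaI finite_lessThan surj_card_le)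
  then show ?thesis
    by (simp add: card_cartesian_product)
qed

text \<open>\<open>W\<close> and its translate by \<open>k\<close> are disjoint subsets of
  \<open>Z\<close> of equal size. With \<open>Z\<close> and \<open>W\<close> the kernels on
  \<open>D\<close> and on \<open>M\<close>, this is the halving that drives the induction.\<close>

lemma (in comm_group) double_card_le_card:
  assumes fin: "finite Z" and "Z \<subseteq> carrier G" and W: "subgroup W G" "W \<subseteq> Z"
    and k: "k \<in> Z" "k \<notin> W" and closed: "\<And>w. w \<in> W \<Longrightarrow> k \<otimes> w \<in> Z"
  shows "2 * card W \<le> card Z"
proof -
  have kG: "k \<in> carrier G" and WG: "W \<subseteq> carrier G"
    using assms by auto
  have "W \<inter> (\<lambda>w. k \<otimes> w) ` W = {}"
  proof (rule ccontr)
    assume "\<not> ?thesis"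
    then obtain u w where "u \<in> W" "w \<in> W" "u = k \<otimes> w"
      by blast
    then have "k = u \<otimes> inv w"
      using kG WG by (simp add: m_assoc subset_iff)
    then have "k \<in> W"
      using \<open>u \<in> W\<close> \<open>w \<in> W\<close> subgroup.m_closed[OF W(1)] subgroup.m_inv_closed[OF W(1)] by simp
    then show False
      using k by simp
  qed
  moreover have "card ((\<lambda>w. k \<otimes> w) ` W) = card W"
    using kG WG by (intro card_image) (auto simp: inj_on_def subset_iff)
  moreover have "finite W"
    using W(2) fin finite_subset by blast
  ultimately have "card (W \<union> (\<lambda>w. k \<otimes> w) ` W) = 2 * card W"
    by (simp add: card_Un_disjoint)
  moreover have "W \<union> (\<lambda>w. k \<otimes> w) ` W \<subseteq> Z"
    using W(2) closed by blast
  ultimately show ?thesis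
    using card_mono[OF fin, of "W \<union> (\<lambda>w. k \<otimes> w) ` W"] by simp
qed

text \<open>Here \<open>z\<close>, \<open>z'\<close> stand for the kernel sizes of \<open>D\<close>
  and \<open>M\<close>, \<open>a\<close>, \<open>b\<close> for the sizes of their images, and
  \<open>c'\<close> for the size of the progression found for \<open>M\<close>. Halving the kernel
  lowers the required density by a factor of at least \<open>s\<close>, which covers the loss in
  keeping \<open>L\<close> translates out of \<open>N\<close>.\<close>

lemma density_step:
  fixes s a b z z' c' L N :: nat
  assumes s: "1 \<le> s" and z: "2 * z' \<le> z" "0 < z'"
    and c': "real c' \<ge> real s powr (- log 2 (real z')) * real b"
    and ab: "a \<le> N * b" and NL: "N \<le> s * L"
  shows "real (L * c') \<ge> real s powr (- log 2 (real z)) * real a"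
proof -
  \<comment> \<open>Halving lowers the binary logarithm by at least 1, and \<open>powr\<close> is
    monotone in the exponent since its base \<open>s\<close> is at least 1.\<close>
  have "log 2 (real z') + 1 = log 2 (2 * real z')"
    using z by (simp add: log_mult)
  also have "\<dots> \<le> log 2 (real z)"
    using z by simp
  finally have "real s powr (- log 2 (real z)) \<le> real s powr (- log 2 (real z') - 1)"
    using s by (intro powr_mono) auto
  also have "\<dots> = real s powr (- log 2 (real z')) / real s"
    using s by (simp add: powr_diff)
  finally have 1: "real s powr (- log 2 (real z)) \<le> real s powr (- log 2 (real z')) / real s" .
  have "a \<le> s * L * b"
    using ab NL by (meson le_trans mult_le_mono1)
  then have "real a \<le> real s * real L * real b"
    by (simp flip: of_nat_mult)
  then have "real s powr (- log 2 (real z)) * real a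
      \<le> real s powr (- log 2 (real z')) / real s * (real s * real L * real b)"
    using 1 by (intro mult_mono) auto
  also have "\<dots> = real L * (real s powr (- log 2 (real z')) * real b)"
    using s by simp
  also have "\<dots> \<le> real L * real c'"
    using c' by (intro mult_left_mono) auto
  finally show ?thesis
    by simp
qed

section \<open>Induction on the size of the kernel\<close>

text \<open>The claim concerns every subgroup \<open>D\<close> because the induction passes to a
  subgroup \<open>M\<close> of it. It carries more than the bounds: \<open>C\<close> nonempty for
  the properness count, \<open>C\<close> inside the image of \<open>D\<close> for comparing
  exponents, and values of \<open>\<psi>\<close> in \<open>D\<close> so that the extended section
  stays in the larger subgroup.\<close>

lemma freiman_section_exists:
  fixes G :: "('a, 'm) monoid_scheme" and E :: "('b, 'n) monoid_scheme" and s :: nat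
  assumes G: "comm_group G" and finG: "finite (carrier G)"
    and E: "comm_group E" and finE: "finite (carrier E)"
    and \<pi>: "\<pi> \<in> hom E G" and s: "1 \<le> s" and D: "subgroup D E"
  shows "\<exists>Ps K' C \<psi>. proper_coset_progression G Ps K' C \<and> C \<noteq> {} \<and> C \<subseteq> \<pi> ` D \<and>
           real (length Ps) \<le> log 2 (real (card {d \<in> D. \<pi> d = \<one>\<^bsub>G\<^esub>})) \<and>
           real (card C) \<ge> real s powr (- log 2 (real (card {d \<in> D. \<pi> d = \<one>\<^bsub>G\<^esub>}))) * real (card (\<pi> ` D)) \<and>
           freiman_hom s G E C \<psi> \<and> \<psi> \<in> C \<rightarrow> D \<and> (\<forall>x \<in> C. \<pi> (\<psi> x) = x)"
  using D
proof (induction "card {d \<in> D. \<pi> d = \<one>\<^bsub>G\<^esub>}" arbitrary: D rule: less_induct)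
  case less
  interpret G: comm_group G by fact
  interpret E: comm_group E by fact
  interpret \<pi>: group_hom E G \<pi>
    using \<pi> by unfold_locales
  define ker where "ker D = {d \<in> D. \<pi> d = \<one>\<^bsub>G\<^esub>}" for D
  have DE: "D \<subseteq> carrier E"
    using less.prems by (rule subgroup.subset)
  have ker_subgroup: "subgroup (ker B) E" if "subgroup B E" for B
  proof -
    have "ker B = B \<inter> kernel E G \<pi>"
      using subgroup.subset[OF that] by (auto simp: ker_def kernel_def)
    then show ?thesis
      using that \<pi>.subgroup_kernel E.subgroups_Inter_pair by simp
  qed
  have \<pi>D: "subgroup (\<pi> ` D) G"
    using less.prems by (rule \<pi>.subgroup_img_is_subgroup)
  show ?case
  proof (cases "ker D = {\<one>\<^bsub>E\<^esub>}")
    case True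
    \<comment> \<open>With trivial kernel the image of \<open>D\<close> is itself the progression: a
      subgroup, of rank 0, with the inverse of \<open>\<pi>\<close> as section.\<close>
    have inj: "inj_on \<pi> D"
    proof (rule inj_onI)
      fix a b assume ab: "a \<in> D" "b \<in> D" "\<pi> a = \<pi> b"
      then have "a \<otimes>\<^bsub>E\<^esub> inv\<^bsub>E\<^esub> b \<in> ker D"
        using DE subgroup.m_closed[OF less.prems] subgroup.m_inv_closed[OF less.prems]
        by (simp add: ker_def subset_iff)
      then have "a \<otimes>\<^bsub>E\<^esub> inv\<^bsub>E\<^esub> b = \<one>\<^bsub>E\<^esub>"
        using True by simp
      then show "a = b"
        using ab DE by (metis E.inv_equality E.inv_inv E.inv_closed subsetD)
    qed
    have "inv_into D \<pi> \<in> \<pi> ` D \<rightarrow> D" "\<And>x. x \<in> \<pi> ` D \<Longrightarrow> \<pi> (inv_into D \<pi> x) = x"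
      by (auto simp: inv_into_into f_inv_into_f)
    moreover from this have "freiman_hom s G E (\<pi> ` D) (inv_into D \<pi>)"
      using freiman_hom_section[OF G E \<pi> less.prems inj] by blast
    moreover have "proper_coset_progression G [] (\<pi> ` D) (\<pi> ` D)"
      using \<pi>D by (simp add: proper_coset_progression_def coset_progression_def)
    moreover have "\<pi> ` D \<noteq> {}"
      using subgroup.one_closed[OF \<pi>D] by blast
    \<comment> \<open>For kernel size 1 both bounds are equalities; \<open>real s powr 0\<close> is
      1 because \<open>s\<close> is positive, whereas base 0 would give 0.\<close>
    ultimately show ?thesis
      using True s unfolding ker_def
      by (intro exI[of _ "[]"] exI[of _ "\<pi> ` D"] exI[of _ "inv_into D \<pi>"]) simp
  next
    case False
    then obtain k where k: "k \<in> ker D" "k \<noteq> \<one>\<^bsub>E\<^esub>"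
      using subgroup.one_closed[OF ker_subgroup[OF less.prems]] by blast
    then have kD: "k \<in> D"
      by (simp add: ker_def)
    \<comment> \<open>The avoidance lemma is applied to \<open>D\<close> as a group in its own
      right, which places \<open>M\<close> inside \<open>D\<close>; subgroups and powers then carry
      over to \<open>E\<close>.\<close>
    interpret D: comm_group "E\<lparr>carrier := D\<rparr>"
    proof (rule group.group_comm_groupI)
      show "Group.group (E\<lparr>carrier := D\<rparr>)"
        using less.prems by (rule E.subgroup_imp_group)
    qed (use DE E.m_comm in auto)
    have finD: "finite D"
      using DE finE finite_subset by blast
    obtain M v where M_D: "subgroup M (E\<lparr>carrier := D\<rparr>)" and kM: "k \<notin> M" and vD: "v \<in> D"
      and gen_D: "\<And>d. d \<in> D \<Longrightarrow> \<exists>(n::nat). \<exists>m \<in> M. d = m \<otimes>\<^bsub>E\<^esub> v [^]\<^bsub>E\<lparr>carrier := D\<rparr>\<^esub> n"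
      using D.subgroup_avoiding_with_cyclic_quotient[of k] k kD finD by auto
    have gen: "\<And>d. d \<in> D \<Longrightarrow> \<exists>(n::nat). \<exists>m \<in> M. d = m \<otimes>\<^bsub>E\<^esub> v [^]\<^bsub>E\<^esub> n"
      using gen_D by (simp flip: E.nat_pow_consistent)
    have M: "subgroup M E"
      using E.incl_subgroup less.prems M_D by blast
    have MD: "M \<subseteq> D"
      using subgroup.subset[OF M_D] by simp
    have vE: "v \<in> carrier E"
      using vD DE by blast
    have z: "2 * card (ker M) \<le> card (ker D)"
    proof (rule E.double_card_le_card)
      show "finite (ker D)" "ker D \<subseteq> carrier E" "ker M \<subseteq> ker D" "k \<notin> ker M"
        using finD DE MD kM by (auto simp: ker_def)
      show "k \<otimes>\<^bsub>E\<^esub> w \<in> ker D" if "w \<in> ker M" for w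
        using that MD k(1) subgroup.m_closed[OF ker_subgroup[OF less.prems]]
        by (auto simp: ker_def)
    qed (use ker_subgroup M k in auto)
    have "finite (ker M)" "\<one>\<^bsub>E\<^esub> \<in> ker M"
      using finite_subset[OF MD finD] subgroup.one_closed[OF ker_subgroup[OF M]]
      by (auto simp: ker_def)
    then have z_pos: "0 < card (ker M)"
      by (auto simp: card_gt_0_iff)
    then have z_less: "card (ker M) < card (ker D)"
      using z by simp
    obtain Ps K' C \<psi> where IH: "proper_coset_progression G Ps K' C" "C \<noteq> {}" "C \<subseteq> \<pi> ` M"
        "real (length Ps) \<le> log 2 (real (card (ker M)))"
        "real (card C) \<ge> real s powr (- log 2 (real (card (ker M)))) * real (card (\<pi> ` M))"
        "freiman_hom s G E C \<psi>" "\<psi> \<in> C \<rightarrow> M" "\<And>x. x \<in> C \<Longrightarrow> \<pi> (\<psi> x) = x"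
      using less.hyps[OF z_less[unfolded ker_def] M] unfolding ker_def by blast
    have \<pi>M: "subgroup (\<pi> ` M) G"
      using M by (rule \<pi>.subgroup_img_is_subgroup)
    have CG: "C \<subseteq> carrier G"
      using IH(3) subgroup.subset[OF \<pi>M] by blast
    define w where "w = \<pi> v"
    have w: "w \<in> carrier G"
      using vE by (simp add: w_def)
    obtain N :: nat where N: "0 < N" "w [^]\<^bsub>G\<^esub> N \<in> \<pi> ` M"
        "\<And>n::nat. 0 < n \<Longrightarrow> n < N \<Longrightarrow> w [^]\<^bsub>G\<^esub> n \<notin> \<pi> ` M"
      using G.least_pow_mem_subgroup[OF finG \<pi>M w] by blast
    have cardD: "card (\<pi> ` D) \<le> N * card (\<pi> ` M)"
      using card_hom_image_le[OF G finG \<pi> E M vE gen N(1)] N(2) by (simp add: w_def)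
    \<comment> \<open>For positive \<open>N\<close> this is the ceiling of \<open>N / s\<close>. It
      is small enough for \<open>s * (L - 1) < N\<close>, which the Freiman property uses, and large
      enough for \<open>N \<le> s * L\<close>, which the density bound uses.\<close>
    define L where "L = Suc ((N - 1) div s)"
    have L: "1 \<le> L" "s * (L - 1) < N"
    proof -
      show "1 \<le> L"
        by (simp add: L_def)
      have "s * (L - 1) \<le> N - 1"
        by (simp add: L_def)
      then show "s * (L - 1) < N"
        using N(1) by simp
    qed
    have NL: "N \<le> s * L"
    proof -
      have "N - 1 < s * L"
        unfolding L_def using s dividend_less_times_div[of s "N - 1"] by simp
      then show ?thesis
        using N(1) by simp
    qed
    \<comment> \<open>Exponents below \<open>L\<close> are thus below \<open>N\<close>, the range in
      which representations are unique.\<close>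
    have LN: "L \<le> N"
    proof -
      have "L - 1 \<le> s * (L - 1)"
        using s by simp
      then show ?thesis
        using L by linarith
    qed
    define F where "F = (\<lambda>(l::nat, c). w [^]\<^bsub>G\<^esub> l \<otimes>\<^bsub>G\<^esub> c)"
    have inj: "inj_on F ({..<L} \<times> C)"
    proof (rule inj_onI)
      fix p q assume "p \<in> {..<L} \<times> C" "q \<in> {..<L} \<times> C" "F p = F q"
      then show "p = q"
        using G.pow_coset_unique[OF \<pi>M w N(3),
              where a = "fst p" and b = "fst q" and c = "snd p" and d = "snd q"] IH(3) LN
        by (auto simp: F_def subset_iff)
    qed
    let ?P = "{\<one>\<^bsub>G\<^esub> \<otimes>\<^bsub>G\<^esub> w [^]\<^bsub>G\<^esub> l | l::nat. l < L}"
    let ?C = "?P <#>\<^bsub>G\<^esub> C"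
    note ext = proper_coset_progression_Cons[OF G IH(1) w L(1) inj[unfolded F_def] CG IH(2)]
    have C_eq: "?C = F ` ({..<L} \<times> C)"
      unfolding F_def by (rule ext(1))
    \<comment> \<open>Since \<open>F\<close> is injective, each point of the progression gives back
      its pair \<open>(l, c)\<close>, so \<open>w\<close> can be lifted to \<open>v\<close> without
      ambiguity.\<close>
    define \<psi>' where "\<psi>' x = (case inv_into ({..<L} \<times> C) F x of (l, c) \<Rightarrow> v [^]\<^bsub>E\<^esub> l \<otimes>\<^bsub>E\<^esub> \<psi> c)" for x
    have \<psi>': "\<psi>' (w [^]\<^bsub>G\<^esub> l \<otimes>\<^bsub>G\<^esub> c) = v [^]\<^bsub>E\<^esub> l \<otimes>\<^bsub>E\<^esub> \<psi> c" if "l < L" "c \<in> C" for l c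
      using inv_into_f_f[OF inj, of "(l, c)"] that by (simp add: \<psi>'_def F_def)
    \<comment> \<open>\<open>v\<close> projects to \<open>w\<close> and \<open>\<psi>\<close> is a
      section over \<open>C\<close>, so the new value projects to \<open>x\<close>; having a
      preimage in \<open>D\<close> also places \<open>x\<close> in the image of
      \<open>D\<close>.\<close>
    have lift: "\<psi>' x \<in> D \<and> \<pi> (\<psi>' x) = x \<and> x \<in> \<pi> ` D" if "x \<in> ?C" for x
    proof -
      obtain l c where lc: "l < L" "c \<in> C" "x = w [^]\<^bsub>G\<^esub> l \<otimes>\<^bsub>G\<^esub> c"
        using \<open>x \<in> ?C\<close> unfolding C_eq F_def by auto
      have "\<psi> c \<in> D"
        using IH(7) MD lc by blast
      moreover have "v [^]\<^bsub>E\<^esub> l \<in> D"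
        using D.nat_pow_closed[of v l] vD by (simp flip: E.nat_pow_consistent)
      ultimately have "\<psi>' x \<in> D"
        using subgroup.m_closed[OF less.prems] lc \<psi>' by simp
      moreover have "\<pi> (\<psi>' x) = x"
        using lc \<psi>' vE \<open>\<psi> c \<in> D\<close> DE IH(8) by (auto simp: w_def \<pi>.hom_nat_pow subset_iff)
      ultimately show ?thesis
        by (metis imageI)
    qed
    have "proper_coset_progression G (?P # Ps) K' ?C"
      by (rule ext(3))
    moreover have "?C \<noteq> {}"
      using IH(2) L(1) unfolding C_eq by (simp add: lessThan_empty_iff bot_nat_def)
    moreover have "?C \<subseteq> \<pi> ` D"
      using lift by blast
    \<comment> \<open>The additional progression is paid for by \<open>log 2 2 = 1\<close>, gained
      from the halved kernel.\<close>
    moreover have "real (length (?P # Ps)) \<le> log 2 (real (card (ker D)))"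
    proof -
      have "real (length (?P # Ps)) \<le> log 2 (2 * real (card (ker M)))"
        using IH(4) z_pos by (simp add: log_mult)
      also have "\<dots> \<le> log 2 (real (card (ker D)))"
        using z z_pos by simp
      finally show ?thesis .
    qed
    moreover have "real (card ?C) \<ge> real s powr (- log 2 (real (card (ker D)))) * real (card (\<pi> ` D))"
      unfolding ext(2) using density_step[OF s z z_pos IH(5) cardD NL] .
    moreover have "freiman_hom s G E ?C \<psi>'"
      unfolding C_eq F_def
      by (rule freiman_hom_extend[OF G E IH(6) \<pi>M IH(3) w vE N(3) L(2) \<psi>'])
    ultimately show ?thesis
      using lift unfolding ker_def by blast
  qed
qed

section \<open>The fibre product of \<open>G\<close> and \<open>H\<close> over
  \<open>H Mod K\<close>\<close>

theorem theorem2p2: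
  fixes G :: "('a, 'm) monoid_scheme" and H :: "('b, 'n) monoid_scheme"
    and K :: "'b set" and \<phi> :: "'a \<Rightarrow> 'b set" and s :: nat
  assumes "comm_group G" and "finite (carrier G)"
    and "comm_group H" and "finite (carrier H)"
    and "subgroup K H"
    and "\<phi> \<in> hom G (H Mod K)"
    and "s \<ge> 2"
  shows "\<exists>Ps K' C \<psi>.
           proper_coset_progression G Ps K' C \<and>
           real (length Ps) \<le> log 2 (real (card K)) \<and>
           real (card C) \<ge> real s powr (- log 2 (real (card K))) * real (card (carrier G)) \<and>
           freiman_hom s G H C \<psi> \<and>
           (\<forall>x \<in> C. \<phi> x = K #>\<^bsub>H\<^esub> \<psi> x)"
proof -
  interpret G: comm_group G by fact
  interpret H: comm_group H by fact
  interpret K: normal K H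
    using assms(5) H.normal_iff_subgroup by simp
  let ?E = "G \<times>\<times> H"
  interpret E: group ?E
    by (rule DirProd_group) unfold_locales
  have E: "comm_group ?E"
    by (rule E.group_comm_groupI) (auto simp: G.m_comm H.m_comm)
  interpret \<phi>: group_hom G "H Mod K" \<phi>
    using assms(6) K.factorgroup_is_group G.group_axioms
    by (simp add: group_hom_def group_hom_axioms_def)
  \<comment> \<open>This is the group of pairs called E in the overview; here \<open>?E\<close> is
    the whole direct product.\<close>
  define D where "D = {(g, h). g \<in> carrier G \<and> h \<in> carrier H \<and> \<phi> g = K #>\<^bsub>H\<^esub> h}"
  have D: "subgroup D ?E"
  proof (rule E.subgroupI)
    show "D \<subseteq> carrier ?E"
      by (auto simp: D_def)
    have "(\<one>\<^bsub>G\<^esub>, \<one>\<^bsub>H\<^esub>) \<in> D"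
      using \<phi>.hom_one K.subset by (simp add: D_def)
    then show "D \<noteq> {}"
      by blast
    show "inv\<^bsub>?E\<^esub> p \<in> D" if "p \<in> D" for p
      using that G.group_axioms H.group_axioms
      by (auto simp: D_def K.inv_FactGroup K.rcos_inv carrier_FactGroup)
    show "p \<otimes>\<^bsub>?E\<^esub> q \<in> D" if "p \<in> D" "q \<in> D" for p q
      using that by (auto simp: D_def K.rcos_sum)
  qed
  have fst_hom: "fst \<in> hom ?E G" and snd_hom: "snd \<in> hom ?E H"
    by (auto simp: hom_def)
  have img: "fst ` D = carrier G"
  proof
    show "carrier G \<subseteq> fst ` D"
    proof
      fix g assume g: "g \<in> carrier G"
      then obtain h where "h \<in> carrier H" "\<phi> g = K #>\<^bsub>H\<^esub> h"
        using \<phi>.hom_closed[OF g] by (auto simp: carrier_FactGroup)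
      then show "g \<in> fst ` D"
        using g by (force simp: D_def)
    qed
  qed (auto simp: D_def)
  \<comment> \<open>\<open>\<phi>\<close> sends the identity to the coset \<open>K\<close>, and the
    coset of \<open>h\<close> equals \<open>K\<close> exactly when \<open>h\<close> lies in
    \<open>K\<close>. So the kernel of the first projection on \<open>D\<close> is a copy of
    \<open>K\<close>, and the bounds become those in terms of \<open>card K\<close>.\<close>
  have "{h \<in> carrier H. \<phi> \<one>\<^bsub>G\<^esub> = K #>\<^bsub>H\<^esub> h} = K"
    unfolding \<phi>.hom_one one_FactGroup
    using H.coset_join1[of K] H.coset_join2[of _ K] assms(5) K.subset by blast
  moreover have "{d \<in> D. fst d = \<one>\<^bsub>G\<^esub>} =
      Pair \<one>\<^bsub>G\<^esub> ` {h \<in> carrier H. \<phi> \<one>\<^bsub>G\<^esub> = K #>\<^bsub>H\<^esub> h}"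
    by (auto simp: D_def simp del: \<phi>.hom_one)
  ultimately have "{d \<in> D. fst d = \<one>\<^bsub>G\<^esub>} = Pair \<one>\<^bsub>G\<^esub> ` K"
    by simp
  then have card_ker: "card {d \<in> D. fst d = \<one>\<^bsub>G\<^esub>} = card K"
    by (simp add: card_image inj_on_def)
  have "finite (carrier ?E)" "1 \<le> s"
    using assms(2,4,7) by auto
  then obtain Ps K' C \<psi> where \<psi>: "proper_coset_progression G Ps K' C"
      "real (length Ps) \<le> log 2 (real (card K))"
      "real (card C) \<ge> real s powr (- log 2 (real (card K))) * real (card (carrier G))"
      "freiman_hom s G ?E C \<psi>" "\<psi> \<in> C \<rightarrow> D" "\<And>x. x \<in> C \<Longrightarrow> fst (\<psi> x) = x"
    using freiman_section_exists[OF assms(1,2) E _ fst_hom _ D, of s] unfolding card_ker img by blast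
  \<comment> \<open>The second projection is a homomorphism, so it turns equal products in
    \<open>?E\<close> into equal products in \<open>H\<close>.\<close>
  have "freiman_hom s G H C (snd \<circ> \<psi>)"
    unfolding freiman_hom_def
  proof (intro conjI ballI impI)
    have \<psi>E: "\<psi> \<in> C \<rightarrow> carrier ?E"
      using \<psi>(4) by (simp add: freiman_hom_def)
    then show "snd \<circ> \<psi> \<in> C \<rightarrow> carrier H"
      by (auto simp: Pi_iff mem_Times_iff)
    have snd_prod: "(\<Otimes>\<^bsub>H\<^esub>i\<in>{1..s}. (snd \<circ> \<psi>) (x i)) = snd (\<Otimes>\<^bsub>?E\<^esub>i\<in>{1..s}. \<psi> (x i))"
      if "x \<in> {1..s} \<rightarrow> C" for x
      using hom_finprod[OF E assms(3) snd_hom, of "{1..s}" "\<lambda>i. \<psi> (x i)"] that \<psi>E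
      by (auto simp: Pi_iff)
    fix x y assume "x \<in> {1..s} \<rightarrow> C" "y \<in> {1..s} \<rightarrow> C"
      and "(\<Otimes>\<^bsub>G\<^esub>i\<in>{1..s}. x i) = (\<Otimes>\<^bsub>G\<^esub>i\<in>{1..s}. y i)"
    moreover from this have "(\<Otimes>\<^bsub>?E\<^esub>i\<in>{1..s}. \<psi> (x i)) = (\<Otimes>\<^bsub>?E\<^esub>i\<in>{1..s}. \<psi> (y i))"
      using \<psi>(4) unfolding freiman_hom_def by blast
    ultimately show "(\<Otimes>\<^bsub>H\<^esub>i\<in>{1..s}. (snd \<circ> \<psi>) (x i)) = (\<Otimes>\<^bsub>H\<^esub>i\<in>{1..s}. (snd \<circ> \<psi>) (y i))"
      using snd_prod by simp
  qed
  \<comment> \<open>The pair \<open>\<psi> x\<close> lies in \<open>D\<close> and has first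
    component \<open>x\<close>; membership in \<open>D\<close> is then the claimed equation.\<close>
  moreover have "\<phi> x = K #>\<^bsub>H\<^esub> (snd \<circ> \<psi>) x" if "x \<in> C" for x
    using \<psi>(5,6) that by (force simp: D_def)
  ultimately show ?thesis
    using \<psi>(1-3) by blast
qed

end
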